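(* Let $\mathfrak{X},\mathfrak{Y},\mathfrak{Z}$ be linear spaces over $\mathbb{K}$ and let $A\subseteq\mathfrak{X}\times\mathfrak{Z}$ and $B\subseteq\mathfrak{Y}\times\mathfrak{Z}$ be two linear relations. The following statements are equivalent: (i) there exists an operator $C$ between $\mathfrak{X}$ and $\mathfrak{Y}$ such that $A\subseteq BC$; (ii) $\mathrm{ran}\,A\subseteq\mathrm{ran}\,B$ and $\mathrm{mul}\,A\subseteq\mathrm{mul}\,B$; (iii) for every $x\in\mathrm{dom}\,A$ there exists $y\in\mathrm{dom}\,B$ such that $A(x)\subseteq B(y)$.
   Context: $\mathbb{K}$ is $\mathbb{R}$ or $\mathbb{C}$. A linear relation between linear spaces $\mathfrak{X}$ and $\mathfrak{Y}$ is a linear subspace $R$ of $\mathfrak{X}\times\mathfrak{Y}$. For $x\in\mathfrak{X}$, $R(x)=\{y:(x,y)\in R\}$. Put $\mathrm{dom}\,R=\{x:(x,y)\in R\text{ for some }y\}$, $\mathrm{ran}\,R=\{y:(x,y)\in R\text{ for some }x\}$, $\mathrm{mul}\,R=R(0)$. For linear relations $R\subseteq\mathfrak{X}\times\mathfrak{Y}$ and $S\subseteq\mathfrak{Y}\times\mathfrak{Z}$ the product is $SR=\{(x,z):(x,y)\in R\text{ and }(y,z)\in S\text{ for some }y\in\mathfrak{Y}\}$. An operator between $\mathfrak{X}$ and $\mathfrak{Y}$ is a linear map defined on a linear subspace of $\mathfrak{X}$ (not necessarily all of $\mathfrak{X}$) with values in $\mathfrak{Y}$; it is identified with its graph, i.e.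 with a linear relation $R\subseteq\mathfrak{X}\times\mathfrak{Y}$ satisfying $\mathrm{mul}\,R=\{0\}$. *)

theory Defs
  imports "HOL-Analysis.Product_Vector"
begin

text \<open>Linear spaces over the real or complex numbers are given by a scalar multiplication
  satisfying \<^const>\<open>vector_space\<close>, with the scalars of class \<^class>\<open>real_normed_field\<close>.
  Both \<^typ>\<open>real\<close> and \<^typ>\<open>complex\<close> are instances of this class, and by the Gelfand-Mazur theorem
  (the norm is multiplicative, so completeness is not needed) every instance is isomorphic to
  one of these two fields.\<close>

definition linear_relation ::
  "('k::field \<Rightarrow> 'x::ab_group_add \<Rightarrow> 'x) \<Rightarrow> ('k \<Rightarrow> 'y::ab_group_add \<Rightarrow> 'y) \<Rightarrow> ('x \<times> 'y) set \<Rightarrow> bool"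
  where "linear_relation sX sY R \<longleftrightarrow> module.subspace (module_prod.scale sX sY) R"

definition mul :: "('x::zero \<times> 'y) set \<Rightarrow> 'y set"
  where "mul R = R `` {0}"

text \<open>An operator is a linear map on a subspace of the first space, identified with its graph.\<close>

definition is_operator ::
  "('k::field \<Rightarrow> 'x::ab_group_add \<Rightarrow> 'x) \<Rightarrow> ('k \<Rightarrow> 'y::ab_group_add \<Rightarrow> 'y) \<Rightarrow> ('x \<times> 'y) set \<Rightarrow> bool"
  where "is_operator sX sY R \<longleftrightarrow> linear_relation sX sY R \<and> mul R = {0}"

text \<open>The product of relations, written right to left as for maps; \<^term>\<open>(O)\<close> composes from
  left to right.\<close>

definition relation_product :: "('y \<times> 'z) set \<Rightarrow> ('x \<times> 'y) set \<Rightarrow> ('x \<times> 'z) set"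
  where "relation_product S R = R O S"

end

theory Submission
  imports Defs
begin

text \<open>The linear relation \<open>B\<^sup>-\<^sup>1 A\<close> relates \<open>x\<close> to every \<open>y\<close> for which \<open>A(x)\<close> and \<open>B(y)\<close> meet, and its
  domain is \<open>dom A\<close> when \<open>ran A \<subseteq> ran B\<close>. Any operator \<open>C\<close> contained in it with the same domain
  (defined by choosing values on a Hamel basis) satisfies \<open>A \<subseteq> B C\<close>, because two elements of \<open>A(x)\<close>
  differ by an element of \<open>mul A \<subseteq> mul B\<close>.\<close>

lemma linear_relation_iff:
  assumes "vector_space sX" "vector_space sY"
  shows "linear_relation sX sY R \<longleftrightarrow> (0, 0) \<in> R \<and>
    (\<forall>x y x' y'. (x, y) \<in> R \<longrightarrow> (x', y') \<in> R \<longrightarrow> (x + x', y + y') \<in> R) \<and>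
    (\<forall>c x y. (x, y) \<in> R \<longrightarrow> (sX c x, sY c y) \<in> R)"
proof -
  interpret X: vector_space sX by fact
  interpret Y: vector_space sY by fact
  interpret P: module_prod sX sY
    by (simp add: module_prod_def module_pair_def X.module_axioms Y.module_axioms)
  show ?thesis
    by (simp add: linear_relation_def P.p.subspace_def P.scale_def zero_prod_def
      Ball_def split_paired_All)
qed

lemma linear_relation_diff:
  assumes "vector_space sX" "vector_space sY" "linear_relation sX sY R"
    and "(x, y) \<in> R" "(x', y') \<in> R"
  shows "(x - x', y - y') \<in> R"
proof -
  interpret X: vector_space sX by fact
  interpret Y: vector_space sY by fact
  note R = assms(3)[unfolded linear_relation_iff[OF assms(1,2)]]
  have "(sX (- 1) x', sY (- 1) y') \<in> R"
    using R assms(5) by blast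
  then have "(x + sX (- 1) x', y + sY (- 1) y') \<in> R"
    using R assms(4) by blast
  then show ?thesis by simp
qed

text \<open>Since \<open>(O)\<close> composes from left to right, \<open>A O B\<inverse>\<close>
  applies \<open>A\<close> first. Sums and scalar multiples of the intermediate points in the third
  space again serve as intermediate points.\<close>

lemma linear_relation_converse_relcomp:
  assumes V: "vector_space sX" "vector_space sY" "vector_space sZ"
    and "linear_relation sX sZ A" "linear_relation sY sZ B"
  shows "linear_relation sX sY (A O B\<inverse>)"
  using assms(4,5) unfolding linear_relation_iff[OF V(1,3)] linear_relation_iff[OF V(2,3)]
    linear_relation_iff[OF V(1,2)]
  by (simp add: relcomp_unfold) meson

text \<open>Values chosen inside \<open>R\<close> on a basis of \<open>Domain R\<close> extend
  linearly, and the extension stays inside \<open>R\<close> because \<open>R\<close> is closed under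
  linear combinations.\<close>

lemma linear_relation_imp_operator:
  assumes V: "vector_space sX" "vector_space sY" and R: "linear_relation sX sY R"
  obtains C where "is_operator sX sY C" "C \<subseteq> R" "Domain C = Domain R"
proof -
  interpret vector_space_pair sX sY
    using V by (simp add: vector_space_pair_def)
  note R' = R[unfolded linear_relation_iff[OF V]]
  have dom: "vs1.subspace (Domain R)"
    unfolding vs1.subspace_def using R' by blast
  obtain b where b: "b \<subseteq> Domain R" "vs1.independent b" "Domain R \<subseteq> vs1.span b"
    using vs1.maximal_independent_subset by blast
  have "\<forall>x\<in>b. \<exists>y. (x, y) \<in> R" using b(1) by blast
  then obtain f where f: "(x, f x) \<in> R" if "x \<in> b" for x by metis
  obtain g where g: "Vector_Spaces.linear sX sY g" "\<And>x. x \<in> b \<Longrightarrow> g x = f x"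
    using linear_independent_extend[OF b(2), of f] by blast
  interpret g: Vector_Spaces.linear sX sY g by fact
  have "(x, g x) \<in> R" if "x \<in> Domain R" for x
  proof -
    have "x \<in> vs1.span b" using that b(3) by blast
    then show ?thesis
    proof (induction rule: vs1.span_induct_alt)
      case base
      show ?case using R' by (simp add: g.zero)
    next
      case (step c x y)
      then have "(sX c x, sY c (g x)) \<in> R" using f R' g(2) by simp
      then show ?case using step R' by (simp add: g.add g.scale)
    qed
  qed
  \<comment> \<open>The map \<open>g\<close> is defined on the whole space, so its graph is cut down
    to \<open>Domain R\<close>.\<close>
  then have "(\<lambda>x. (x, g x)) ` Domain R \<subseteq> R" by blast
  moreover have "is_operator sX sY ((\<lambda>x. (x, g x)) ` Domain R)"
    using dom by (auto simp: is_operator_def linear_relation_iff[OF V] mul_def image_iff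
      vs1.subspace_def g.zero g.add g.scale)
  moreover have "Domain ((\<lambda>x. (x, g x)) ` Domain R) = Domain R" by auto
  ultimately show thesis using that by metis
qed

theorem theorem3p1:
  fixes sX :: "'k::real_normed_field \<Rightarrow> 'x::ab_group_add \<Rightarrow> 'x"
    and sY :: "'k \<Rightarrow> 'y::ab_group_add \<Rightarrow> 'y"
    and sZ :: "'k \<Rightarrow> 'z::ab_group_add \<Rightarrow> 'z"
    and A :: "('x \<times> 'z) set"
    and B :: "('y \<times> 'z) set"
  assumes "vector_space sX" and "vector_space sY" and "vector_space sZ"
    and "linear_relation sX sZ A" and "linear_relation sY sZ B"
  shows "((\<exists>C :: ('x \<times> 'y) set. is_operator sX sY C \<and> A \<subseteq> relation_product B C) \<longleftrightarrow>
            Range A \<subseteq> Range B \<and> mul A \<subseteq> mul B) \<and>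
         (Range A \<subseteq> Range B \<and> mul A \<subseteq> mul B \<longleftrightarrow>
            (\<forall>x \<in> Domain A. \<exists>y \<in> Domain B. A `` {x} \<subseteq> B `` {y}))"
    (is "(?i \<longleftrightarrow> ?ii) \<and> (_ \<longleftrightarrow> ?iii)")
proof -
  note A = assms(1,3,4) and B = assms(2,3,5)
  \<comment> \<open>The equivalences follow from the cycle (i) to (iii) to (ii) to (i).\<close>
  have "?iii" if ?i
  proof
    fix x assume "x \<in> Domain A"
    from that obtain C where C: "is_operator sX sY C" "A \<subseteq> C O B"
      by (auto simp: relation_product_def)
    \<comment> \<open>As \<open>C\<close> is single-valued, every element of \<open>A(x)\<close> is
      reached through the same \<open>y\<close>, which gives the inclusion of \<open>A(x)\<close> in
      \<open>B(y)\<close>.\<close>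
    have unique: "y = y'" if "(x, y) \<in> C" "(x, y') \<in> C" for y y'
    proof -
      have "(0, y - y') \<in> C"
        using linear_relation_diff[OF assms(1,2) _ that] C(1) by (simp add: is_operator_def)
      then have "y - y' \<in> mul C" by (simp add: mul_def)
      then have "y - y' \<in> {0}"
        using C(1) by (simp only: is_operator_def)
      then show ?thesis by simp
    qed
    obtain y z where "(x, y) \<in> C" "(y, z) \<in> B"
      using \<open>x \<in> Domain A\<close> C(2) by blast
    then show "\<exists>y \<in> Domain B. A `` {x} \<subseteq> B `` {y}"
      using C(2) unique by blast
  qed
  moreover have "?ii" if iii: ?iii
  proof
    show "Range A \<subseteq> Range B" using that by blast
    show "mul A \<subseteq> mul B"
    proof
      fix z assume "z \<in> mul A"
      \<comment> \<open>This puts 0 into \<open>Domain A\<close>, so (iii) yields one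
        \<open>y\<close> related by \<open>B\<close> to both \<open>z\<close> and 0; subtracting the
        two pairs moves \<open>z\<close> into \<open>mul B\<close>.\<close>
      moreover have "(0, 0) \<in> A" using A by (simp add: linear_relation_iff)
      ultimately obtain y where "(y, z) \<in> B" "(y, 0) \<in> B"
        using iii unfolding mul_def by blast
      then show "z \<in> mul B"
        using linear_relation_diff[OF B, of y z y 0] by (simp add: mul_def)
    qed
  qed
  moreover have "?i" if ?ii
  proof -
    obtain C where C: "is_operator sX sY C" "C \<subseteq> A O B\<inverse>" "Domain C = Domain (A O B\<inverse>)"
      using linear_relation_imp_operator[OF assms(1,2) linear_relation_converse_relcomp[OF assms]]
      by blast
    have "A \<subseteq> C O B"
    proof safe
      fix x z assume xz: "(x, z) \<in> A"
      \<comment> \<open>By the range inclusion, \<open>z\<close> has a preimage under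
        \<open>B\<close>, so \<open>x\<close> lies in the domain of
        \<open>A O B\<inverse>\<close>.\<close>
      then have "x \<in> Domain C" using that C(3) by blast
      then obtain y z' where y: "(x, y) \<in> C" "(x, z') \<in> A" "(y, z') \<in> B" using C(2) by blast
      have "z - z' \<in> mul A"
        using linear_relation_diff[OF A xz y(2)] by (simp add: mul_def)
      then have "(0, z - z') \<in> B" using that by (auto simp: mul_def)
      \<comment> \<open>The value \<open>y\<close> was chosen for some \<open>z'\<close> in
        \<open>A(x)\<close>; adding the pair over 0 replaces \<open>z'\<close> by \<open>z\<close>
        without changing \<open>y\<close>.\<close>
      then have "(y + 0, z' + (z - z')) \<in> B"
        using y(3) assms(5) unfolding linear_relation_iff[OF assms(2,3)] by blast
      then show "(x, z) \<in> C O B" using y(1) by auto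
    qed
    then show ?thesis using C(1) by (auto simp: relation_product_def)
  qed
  ultimately show ?thesis by blast
qed

end
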